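(* Let $(X,d_X)$ and $(Y,d_Y)$ be metric spaces, let $(M^x_t)_{t\ge0}$ be a right-continuous stochastic process on $(X,d_X)$ starting in $x\in X$, and let $\varphi:(X,d_X)\to(Y,d_Y)$ be a map which is locally $\alpha$-Hölder regular at $x$ for some $\alpha\in(0,1)$. Suppose that the local walk dimension $\dim_{\mathcal W}(X,M;x)$ of $M$ at $x$ exists. Then the upper local walk dimension of $\varphi(M)$ at $\varphi(x)$ satisfies $$\overline{\dim_{\mathcal W}}\big(Y,\varphi(M);\varphi(x)\big)\le\frac1\alpha\dim_{\mathcal W}(X,M;x).$$
   Context: For a process $M$ on a metric space $X$ started at $x$, let $\tau_M(r)$ be its first exit time from the open ball $B_X(x,r)$. The local walk dimension is $\dim_{\mathcal W}(X,M;x):=\lim_{r\searrow0}\frac{\log\mathbf E_x[\tau_M(r)]}{\log r}$, and the upper local walk dimension is $\overline{\dim_{\mathcal W}}(X,M;x):=\limsup_{r\searrow0}\frac{\log\mathbf E_x[\tau_M(r)]}{\log r}$. $\varphi(M)$ denotes the $Y$-valued process $(\varphi(M^x_t))_{t\ge0}$, started at $\varphi(x)$. For $\beta\in(0,1]$, $\varphi$ is locally $\beta$-Hölder continuous at $x$ if there exist an open neighbourhood $U$ of $x$ and a constant $C>0$ with $d_Y(\varphi(x),\varphi(y))\le C\,d_X(x,y)^\beta$ for all $y\in U$. $\varphi$ is locally $\alpha$-Hölder regular at $x$ if $\alpha$ is the supremum of all $\beta\in(0,1]$ for which $\varphi$ is locally $\beta$-Hölder continuous at $x$. *)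

theory Defs
  imports "HOL-Probability.Probability"
begin

text \<open>Time is \<open>t \<ge> 0\<close>; the values of \<open>M t\<close> for negative \<open>t\<close> are irrelevant.\<close>

definition right_continuous_process ::
    "'w measure \<Rightarrow> (real \<Rightarrow> 'w \<Rightarrow> 'a::metric_space) \<Rightarrow> 'a \<Rightarrow> bool" where
  "right_continuous_process P M x \<longleftrightarrow>
     prob_space P \<and>
     (\<forall>t\<ge>0. M t \<in> borel_measurable P) \<and>
     (AE \<omega> in P. M 0 \<omega> = x) \<and>
     (AE \<omega> in P. \<forall>t\<ge>0. continuous (at_right t) (\<lambda>s. M s \<omega>))"

text \<open>The infimum of the empty set is \<open>\<infinity>\<close>: a path that never leaves the ball has infinite exit time.\<close>

definition exit_time ::
    "(real \<Rightarrow> 'w \<Rightarrow> 'a::metric_space) \<Rightarrow> 'a \<Rightarrow> real \<Rightarrow> 'w \<Rightarrow> ennreal" where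
  "exit_time M x r \<omega> = Inf (ennreal ` {t. 0 \<le> t \<and> M t \<omega> \<notin> ball x r})"

text \<open>The expectation is the nonnegative integral, with values in \<open>[0, \<infinity>]\<close>. Exit times need not be
  measurable with respect to \<open>P\<close> itself; by \<open>nn_integral_completion\<close> the value agrees with the
  integral over the completion of \<open>P\<close>, and for arbitrary functions it is the lower integral.\<close>

definition mean_exit_time ::
    "'w measure \<Rightarrow> (real \<Rightarrow> 'w \<Rightarrow> 'a::metric_space) \<Rightarrow> 'a \<Rightarrow> real \<Rightarrow> ennreal" where
  "mean_exit_time P M x r = (\<integral>\<^sup>+ \<omega>. exit_time M x r \<omega> \<partial>P)"

definition ln_ennreal :: "ennreal \<Rightarrow> ereal" where
  "ln_ennreal a = (if a = 0 then - \<infinity> else if a = \<infinity> then \<infinity> else ereal (ln (enn2real a)))"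

definition walk_quotient ::
    "'w measure \<Rightarrow> (real \<Rightarrow> 'w \<Rightarrow> 'a::metric_space) \<Rightarrow> 'a \<Rightarrow> real \<Rightarrow> ereal" where
  "walk_quotient P M x r = ln_ennreal (mean_exit_time P M x r) / ereal (ln r)"

definition local_walk_dim_exists ::
    "'w measure \<Rightarrow> (real \<Rightarrow> 'w \<Rightarrow> 'a::metric_space) \<Rightarrow> 'a \<Rightarrow> bool" where
  "local_walk_dim_exists P M x \<longleftrightarrow> (\<exists>d. (walk_quotient P M x \<longlongrightarrow> d) (at_right 0))"

definition local_walk_dim ::
    "'w measure \<Rightarrow> (real \<Rightarrow> 'w \<Rightarrow> 'a::metric_space) \<Rightarrow> 'a \<Rightarrow> ereal" where
  "local_walk_dim P M x = Lim (at_right 0) (walk_quotient P M x)"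

definition upper_local_walk_dim ::
    "'w measure \<Rightarrow> (real \<Rightarrow> 'w \<Rightarrow> 'a::metric_space) \<Rightarrow> 'a \<Rightarrow> ereal" where
  "upper_local_walk_dim P M x = Limsup (at_right 0) (walk_quotient P M x)"

definition locally_holder_continuous_at ::
    "real \<Rightarrow> ('a::metric_space \<Rightarrow> 'b::metric_space) \<Rightarrow> 'a \<Rightarrow> bool" where
  "locally_holder_continuous_at \<beta> \<phi> x \<longleftrightarrow>
     (\<exists>U C. open U \<and> x \<in> U \<and> C > 0 \<and> (\<forall>y\<in>U. dist (\<phi> x) (\<phi> y) \<le> C * dist x y powr \<beta>))"

text \<open>Nonemptiness is required because \<open>Sup {}\<close> is an unspecified real number; the set is bounded
  above by \<open>1\<close>.\<close>

definition locally_holder_regular_at ::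
    "real \<Rightarrow> ('a::metric_space \<Rightarrow> 'b::metric_space) \<Rightarrow> 'a \<Rightarrow> bool" where
  "locally_holder_regular_at \<alpha> \<phi> x \<longleftrightarrow>
     (let S = {\<beta>. 0 < \<beta> \<and> \<beta> \<le> 1 \<and> locally_holder_continuous_at \<beta> \<phi> x}
      in S \<noteq> {} \<and> \<alpha> = Sup S)"

end

theory Submission
  imports Defs "HOL-Real_Asymp.Real_Asymp"
begin

text \<open>If \<open>dist (\<phi> x) (\<phi> y) \<le> C * dist x y powr \<gamma>\<close> near \<open>x\<close>, then \<open>\<phi>\<close> maps the ball of radius
  \<open>s = (r / C) powr (1 / \<gamma>)\<close> around \<open>x\<close> into the ball of radius \<open>r\<close> around \<open>\<phi> x\<close>, so the image process
  needs at least as long to leave the latter as \<open>M\<close> needs to leave the former. Dividing the logarithms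
  of the mean exit times by \<open>ln r < 0\<close> and using \<open>ln s / ln r \<longlongrightarrow> 1 / \<gamma>\<close> bounds the upper walk
  dimension by \<open>1 / \<gamma>\<close> times the walk dimension. Finally \<open>\<gamma>\<close> tends to \<open>\<alpha>\<close> along admissible
  exponents.\<close>

lemma ln_ennreal_mono:
  assumes "a \<le> b"
  shows "ln_ennreal a \<le> ln_ennreal b"
proof (cases "a = 0 \<or> b = \<infinity>")
  case False
  then have "0 < a" "b < \<infinity>" "a < \<infinity>" "0 < b"
    using assms by (auto simp: less_top[symmetric] top_unique zero_less_iff_neq_zero)
  then show ?thesis
    using assms by (auto simp: ln_ennreal_def less_top enn2real_positive_iff intro!: enn2real_mono)
qed (use assms in \<open>auto simp: ln_ennreal_def\<close>)

lemma ereal_divide_right_antimono: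
  fixes a b :: ereal
  assumes "a \<le> b" "c < 0"
  shows "b / ereal c \<le> a / ereal c"
  using assms by (cases a; cases b) (auto simp: divide_right_mono_neg)

text \<open>Whenever the image path is outside \<open>ball (\<phi> x) r\<close>, the original path
  is outside \<open>ball x s\<close>, so the infimum on the right runs over a subset.\<close>

lemma exit_time_image_ge:
  assumes "\<And>y. y \<in> ball x s \<Longrightarrow> \<phi> y \<in> ball (\<phi> x) r"
  shows "exit_time M x s \<omega> \<le> exit_time (\<lambda>t \<omega>. \<phi> (M t \<omega>)) (\<phi> x) r \<omega>"
  unfolding exit_time_def using assms by (intro Inf_superset_mono image_mono) blast

lemma mean_exit_time_image_ge:
  assumes "\<And>y. y \<in> ball x s \<Longrightarrow> \<phi> y \<in> ball (\<phi> x) r"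
  shows "mean_exit_time P M x s \<le> mean_exit_time P (\<lambda>t \<omega>. \<phi> (M t \<omega>)) (\<phi> x) r"
  unfolding mean_exit_time_def using assms by (intro nn_integral_mono exit_time_image_ge)

lemma walk_quotient_image_le:
  assumes ball: "\<And>y. y \<in> ball x s \<Longrightarrow> \<phi> y \<in> ball (\<phi> x) r"
    and "0 < r" "r < 1" "0 < s" "s < 1"
  shows "walk_quotient P (\<lambda>t \<omega>. \<phi> (M t \<omega>)) (\<phi> x) r
           \<le> ereal (ln s / ln r) * walk_quotient P M x s"
proof -
  have neg: "ln r < 0" "ln s < 0"
    using assms by auto
  \<comment> \<open>Only the finite denominators are rewritten, so the change of scale from
    \<open>ln r\<close> to \<open>ln s\<close> stays valid when the logarithm of the mean exit time
    is infinite.\<close>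
  have inv: "inverse (ereal (ln r)) = ereal (ln s / ln r) * inverse (ereal (ln s))"
    using neg by (simp add: field_simps)
  have "walk_quotient P (\<lambda>t \<omega>. \<phi> (M t \<omega>)) (\<phi> x) r \<le> ln_ennreal (mean_exit_time P M x s) / ereal (ln r)"
    unfolding walk_quotient_def using neg
    by (intro ereal_divide_right_antimono ln_ennreal_mono mean_exit_time_image_ge ball) auto
  also have "\<dots> = ereal (ln s / ln r) * walk_quotient P M x s"
    unfolding walk_quotient_def divide_ereal_def inv by (simp only: mult_ac)
  finally show ?thesis .
qed

lemma upper_local_walk_dim_image_le:
  assumes holder: "locally_holder_continuous_at \<gamma> \<phi> x" and "0 < \<gamma>"
    and lim: "(walk_quotient P M x \<longlongrightarrow> d) (at_right 0)"
  shows "upper_local_walk_dim P (\<lambda>t \<omega>. \<phi> (M t \<omega>)) (\<phi> x) \<le> ereal (1 / \<gamma>) * d"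
proof -
  obtain U C where U: "open U" "x \<in> U" and "0 < C"
    and C: "\<And>y. y \<in> U \<Longrightarrow> dist (\<phi> x) (\<phi> y) \<le> C * dist x y powr \<gamma>"
    using holder unfolding locally_holder_continuous_at_def by blast
  obtain \<delta> where "0 < \<delta>" and \<delta>: "ball x \<delta> \<subseteq> U"
    using U open_contains_ball by blast
  define s where "s r = (r / C) powr (1 / \<gamma>)" for r
  have s0: "filterlim s (at_right 0) (at_right 0)"
    unfolding s_def using \<open>0 < C\<close> \<open>0 < \<gamma>\<close> by real_asymp
  have "((\<lambda>r. ln (s r) / ln r) \<longlongrightarrow> 1 / \<gamma>) (at_right 0)"
    unfolding s_def using \<open>0 < C\<close> \<open>0 < \<gamma>\<close> by real_asymp
  \<comment> \<open>The first factor tends to the finite nonzero number \<open>1 / \<gamma>\<close>,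
    so an infinite \<open>d\<close> causes no indeterminate product.\<close>
  then have "((\<lambda>r. ereal (ln (s r) / ln r) * walk_quotient P M x (s r)) \<longlongrightarrow> ereal (1 / \<gamma>) * d) (at_right 0)"
    using \<open>0 < \<gamma>\<close> by (intro tendsto_mult_ereal filterlim_compose[OF lim s0]) auto
  then have Limsup: "Limsup (at_right 0) (\<lambda>r. ereal (ln (s r) / ln r) * walk_quotient P M x (s r)) = ereal (1 / \<gamma>) * d"
    by (intro lim_imp_Limsup) auto
  have "\<forall>\<^sub>F r in at_right 0. walk_quotient P (\<lambda>t \<omega>. \<phi> (M t \<omega>)) (\<phi> x) r
      \<le> ereal (ln (s r) / ln r) * walk_quotient P M x (s r)"
  proof -
    \<comment> \<open>The bound by \<open>\<delta>\<close> keeps the ball of radius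
      \<open>s r\<close> inside \<open>U\<close>; the bound by 1 makes \<open>ln (s r)\<close>
      negative.\<close>
    have "\<forall>\<^sub>F r in at_right 0. s r \<in> {0<..<min \<delta> 1}"
      using \<open>0 < \<delta>\<close> by (intro eventually_compose_filterlim[OF eventually_at_right_real s0]) auto
    moreover have "\<forall>\<^sub>F r in at_right (0::real). r \<in> {0<..<1}"
      by (intro eventually_at_right_real) auto
    ultimately show ?thesis
    proof eventually_elim
      case (elim r)
      have "\<phi> y \<in> ball (\<phi> x) r" if y: "y \<in> ball x (s r)" for y
      proof -
        have "dist (\<phi> x) (\<phi> y) \<le> C * dist x y powr \<gamma>"
          using y elim \<delta> by (intro C) auto
        \<comment> \<open>The target ball is open, so strictness is needed; it comes from
          \<open>y\<close> lying in an open ball and \<open>\<gamma> > 0\<close>. The radius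
          \<open>s r\<close> solves \<open>C * s r powr \<gamma> = r\<close>.\<close>
        also have "\<dots> < C * s r powr \<gamma>"
          using y \<open>0 < C\<close> \<open>0 < \<gamma>\<close> by (intro mult_strict_left_mono powr_less_mono2) auto
        also have "\<dots> = r"
          using elim \<open>0 < C\<close> \<open>0 < \<gamma>\<close> by (simp add: s_def powr_powr)
        finally show ?thesis
          by simp
      qed
      then show ?case
        using elim by (intro walk_quotient_image_le) auto
    qed
  qed
  from Limsup_mono[OF this] show ?thesis
    unfolding upper_local_walk_dim_def Limsup .
qed

theorem lemma3p10:
  fixes P :: "'w measure"
    and M :: "real \<Rightarrow> 'w \<Rightarrow> 'a::metric_space"
    and x :: 'a
    and \<phi> :: "'a \<Rightarrow> 'b::metric_space"
    and \<alpha> :: real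
  assumes "right_continuous_process P M x"
    and "0 < \<alpha>" and "\<alpha> < 1"
    and "locally_holder_regular_at \<alpha> \<phi> x"
    and "local_walk_dim_exists P M x"
  shows "upper_local_walk_dim P (\<lambda>t \<omega>. \<phi> (M t \<omega>)) (\<phi> x)
           \<le> ereal (1 / \<alpha>) * local_walk_dim P M x"
proof -
  define S where "S = {\<beta>. 0 < \<beta> \<and> \<beta> \<le> 1 \<and> locally_holder_continuous_at \<beta> \<phi> x}"
  obtain d where lim: "(walk_quotient P M x \<longlongrightarrow> d) (at_right 0)"
    using assms(5) unfolding local_walk_dim_exists_def by blast
  then have d: "local_walk_dim P M x = d"
    unfolding local_walk_dim_def by (intro tendsto_Lim) auto
  have "S \<noteq> {}" "\<alpha> = Sup S"
    using assms(4) unfolding locally_holder_regular_at_def S_def Let_def by auto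
  moreover have "bdd_above S"
    unfolding S_def by (intro bdd_aboveI[of _ 1]) auto
  \<comment> \<open>The supremum may fail to be attained, so the bound is proved for exponents in
    \<open>S\<close> and then passed to the limit.\<close>
  ultimately have "\<alpha> \<in> closure S"
    using closure_contains_Sup by blast
  then obtain \<gamma> where \<gamma>: "\<And>n. \<gamma> n \<in> S" and "\<gamma> \<longlonglongrightarrow> \<alpha>"
    unfolding closure_sequential by blast
  \<comment> \<open>Again \<open>1 / \<alpha>\<close> is finite and nonzero, so \<open>d\<close> may
    be infinite.\<close>
  then have "(\<lambda>n. ereal (1 / \<gamma> n) * d) \<longlonglongrightarrow> ereal (1 / \<alpha>) * d"
    using \<open>0 < \<alpha>\<close> by (intro tendsto_mult_ereal tendsto_intros) (auto intro!: tendsto_intros)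
  moreover have "upper_local_walk_dim P (\<lambda>t \<omega>. \<phi> (M t \<omega>)) (\<phi> x) \<le> ereal (1 / \<gamma> n) * d" for n
    using \<gamma>[of n] lim by (intro upper_local_walk_dim_image_le) (auto simp: S_def)
  ultimately show ?thesis
    unfolding d by (intro LIMSEQ_le_const) auto
qed

end
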